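(* Suppose that for each $\delta\in\mathcal K^*\setminus\{0\}$ there exists $x_\delta\in\mathcal S(A,\mathcal K,\mathcal B)$ with $\langle\delta,x_\delta\rangle>0$. Let $(\mu;\eta_0)$ be a $\mathcal K$-sublinear inequality satisfying $-\infty<\eta_0=\inf_{b\in\mathcal B}\sigma_{D_\mu}(b)$, where $D_\mu=\{\lambda\in\mathbb R^m:\mu-A^*\lambda\in\mathcal K^*\}$, and let $\widehat{\mathcal B}=\{b\in\mathcal B:\sigma_{D_\mu}(b)\le\eta_0\}$. If there exist (finitely many) $b^i\in\widehat{\mathcal B}$ and $x^i\in\mathcal K$ such that $\sum_i x^i\in\mathrm{int}(\mathcal K)$, $Ax^i=b^i$ and $\langle\mu,x^i\rangle=\eta_0$ for all $i$, then $(\mu;\eta_0)$ is $\mathcal K$-minimal.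
   Context: $E$ is a finite-dimensional Euclidean space with inner product $\langle\cdot,\cdot\rangle$; $\mathcal K\subset E$ is a regular cone (closed, convex, pointed, full-dimensional); $\mathcal K^*=\{y\in E:\langle x,y\rangle\ge0\ \forall x\in\mathcal K\}$ is its dual cone; $\mathrm{Ext}(\cdot)$ denotes the set of (nonzero vectors spanning) extreme rays of a cone; $A:E\to\mathbb R^m$ is linear with conjugate map $A^*:\mathbb R^m\to E$ given by $y^TAx=\langle A^*y,x\rangle$; $\mathcal B\subseteq\mathbb R^m$ is an arbitrary nonempty set; $\mathcal S(A,\mathcal K,\mathcal B)=\{x\in\mathcal K: Ax\in\mathcal B\}$, assumed to satisfy $\mathcal S(A,\mathcal K,\mathcal B)\neq\emptyset$ and $\mathcal S(A,\mathcal K,\mathcal B)\ne\mathcal K$. The support function of $D\subseteq\mathbb R^m$ is $\sigma_D(z)=\sup\{z^T\lambda:\lambda\in D\}$ (with $\sup\emptyset=-\infty$). A pair $(\mu;\eta_0)\in E\times\mathbb R$ is a valid inequality if $\langle\mu,x\rangle\ge\eta_0$ for all $x\in \mathcal S(A,\mathcal K,\mathcal B)$. A valid inequality $(\mu;\eta_0)$ with $\mu\neq0$ is $\mathcal K$-minimal if every valid inequality $(\rho;\rho_0)$ with $\rho\ne\mu$ and $\mu-\rho\in\mathcal K^*$ satisfies $\rho_0<\eta_0$. An inequality $(\mu;\eta_0)$ with $\mu\ne0$, $\eta_0\in\mathbb R$, is $\mathcal K$-sublinear if (A.1) for every $\alpha\in\mathrm{Ext}(\mathcal K^* )$: $0\le\langle\mu,u\rangle$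 for all $u\in E$ such that $Au=0$ and $\langle\alpha,v\rangle u+v\in\mathcal K$ for all $v\in\mathrm{Ext}(\mathcal K)$; and (A.2) $\eta_0\le\langle\mu,x\rangle$ for all $x\in\mathcal S(A,\mathcal K,\mathcal B)$. *)

theory Defs
  imports "HOL-Analysis.Analysis"
begin

definition regular_cone :: "'a::euclidean_space set \<Rightarrow> bool" where
  "regular_cone K \<longleftrightarrow>
     cone K \<and> closed K \<and> convex K \<and> K \<inter> uminus ` K = {0} \<and> interior K \<noteq> {}"

definition dual_cone :: "'a::euclidean_space set \<Rightarrow> 'a set" where
  "dual_cone K = {y. \<forall>x\<in>K. 0 \<le> x \<bullet> y}"

(* Every nonzero point of an extreme ray is included, without normalization:
   cone hull {v} is the ray of all nonnegative multiples of v. *)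
definition Ext :: "'a::euclidean_space set \<Rightarrow> 'a set" where
  "Ext K = {v. v \<noteq> 0 \<and> (cone hull {v}) face_of K}"

definition solution_set :: "('a::euclidean_space \<Rightarrow> real ^ 'm) \<Rightarrow> 'a set \<Rightarrow> (real ^ 'm) set \<Rightarrow> 'a set"
  where "solution_set A K B = {x \<in> K. A x \<in> B}"

(* Values in ereal: the supremum is -\<infinity> over the empty set and \<infinity> in unbounded directions. *)
definition support_function :: "(real ^ 'm) set \<Rightarrow> real ^ 'm \<Rightarrow> ereal" where
  "support_function D z = (SUP l\<in>D. ereal (z \<bullet> l))"

definition valid_inequality ::
  "('a::euclidean_space \<Rightarrow> real ^ 'm) \<Rightarrow> 'a set \<Rightarrow> (real ^ 'm) set \<Rightarrow> 'a \<Rightarrow> real \<Rightarrow> bool" where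
  "valid_inequality A K B \<mu> \<eta>0 \<longleftrightarrow> (\<forall>x\<in>solution_set A K B. \<mu> \<bullet> x \<ge> \<eta>0)"

definition K_minimal ::
  "('a::euclidean_space \<Rightarrow> real ^ 'm) \<Rightarrow> 'a set \<Rightarrow> (real ^ 'm) set \<Rightarrow> 'a \<Rightarrow> real \<Rightarrow> bool" where
  "K_minimal A K B \<mu> \<eta>0 \<longleftrightarrow>
     valid_inequality A K B \<mu> \<eta>0 \<and> \<mu> \<noteq> 0 \<and>
     (\<forall>\<rho> \<rho>0. valid_inequality A K B \<rho> \<rho>0 \<and> \<rho> \<noteq> \<mu> \<and> \<mu> - \<rho> \<in> dual_cone K \<longrightarrow> \<rho>0 < \<eta>0)"

definition K_sublinear ::
  "('a::euclidean_space \<Rightarrow> real ^ 'm) \<Rightarrow> 'a set \<Rightarrow> (real ^ 'm) set \<Rightarrow> 'a \<Rightarrow> real \<Rightarrow> bool" where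
  "K_sublinear A K B \<mu> \<eta>0 \<longleftrightarrow>
     \<mu> \<noteq> 0 \<and>
     (\<forall>\<alpha>\<in>Ext (dual_cone K). \<forall>u.
        A u = 0 \<and> (\<forall>v\<in>Ext K. (\<alpha> \<bullet> v) *\<^sub>R u + v \<in> K) \<longrightarrow> 0 \<le> \<mu> \<bullet> u) \<and>
     (\<forall>x\<in>solution_set A K B. \<eta>0 \<le> \<mu> \<bullet> x)"

definition D_set :: "('a::euclidean_space \<Rightarrow> real ^ 'm) \<Rightarrow> 'a set \<Rightarrow> 'a \<Rightarrow> (real ^ 'm) set" where
  "D_set A K \<mu> = {l. \<mu> - adjoint A l \<in> dual_cone K}"

definition B_hat ::
  "('a::euclidean_space \<Rightarrow> real ^ 'm) \<Rightarrow> 'a set \<Rightarrow> (real ^ 'm) set \<Rightarrow> 'a \<Rightarrow> real \<Rightarrow> (real ^ 'm) set" where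
  "B_hat A K B \<mu> \<eta>0 = {b \<in> B. support_function (D_set A K \<mu>) b \<le> ereal \<eta>0}"

end

theory Submission
  imports Defs
begin

text \<open>
  Suppose a valid inequality \<open>(\<rho>; \<rho>0)\<close> with \<open>\<rho> \<noteq> \<mu>\<close> and
  \<open>\<delta> = \<mu> - \<rho>\<close> in the dual cone had \<open>\<rho>0 \<ge> \<eta>0\<close>. Each \<open>x i\<close> is a feasible point at
  which \<open>(\<mu>; \<eta>0)\<close> is tight, so validity of \<open>\<rho>\<close> there leaves no room for \<open>\<delta>\<close>:
  \<open>\<delta> \<bullet> x i \<le> \<eta>0 - \<rho>0 \<le> 0\<close>. Summing over \<open>i\<close>, the functional \<open>\<delta>\<close> is nonpositive at an
  interior point of the cone, although a nonzero element of the dual cone is strictly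
  positive throughout the interior. Condition (A.2) of sublinearity is the validity of
  \<open>(\<mu>; \<eta>0)\<close> itself.
\<close>

text \<open>
  From an interior point one can move a little in direction \<open>-\<delta>\<close> and stay in the set, which
  lowers the value of \<open>\<delta>\<close> strictly while keeping it nonnegative.
\<close>

lemma dual_cone_inner_pos_interior:
  fixes K :: "'a::euclidean_space set"
  assumes "\<delta> \<in> dual_cone K" and "\<delta> \<noteq> 0" and "z \<in> interior K"
  shows "0 < \<delta> \<bullet> z"
proof -
  obtain e where e: "e > 0" "cball z e \<subseteq> K"
    using assms(3) by (auto simp: mem_interior_cball)
  define t where "t = e / norm \<delta>"
  have t: "t > 0"
    using e(1) assms(2) by (simp add: t_def)
  have "z - t *\<^sub>R \<delta> \<in> cball z e"
    using e(1) assms(2) by (simp add: t_def dist_norm)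
  then have "0 \<le> (z - t *\<^sub>R \<delta>) \<bullet> \<delta>"
    using e(2) assms(1) unfolding dual_cone_def by blast
  then have "t * (\<delta> \<bullet> \<delta>) \<le> \<delta> \<bullet> z"
    by (simp add: inner_diff_left inner_commute[of z])
  moreover have "0 < t * (\<delta> \<bullet> \<delta>)"
    using t assms(2) by simp
  ultimately show ?thesis
    by linarith
qed

theorem proposition4p6:
  fixes A :: "'a::euclidean_space \<Rightarrow> real ^ 'm"
    and K :: "'a set" and B :: "(real ^ 'm) set"
    and \<mu> :: 'a and \<eta>0 :: real
  assumes "regular_cone K"
    and "linear A"
    and "B \<noteq> {}"
    and "solution_set A K B \<noteq> {}"
    and "solution_set A K B \<noteq> K"
    and "\<forall>\<delta>\<in>dual_cone K - {0}. \<exists>x\<in>solution_set A K B. \<delta> \<bullet> x > 0"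
    and "K_sublinear A K B \<mu> \<eta>0"
    and "ereal \<eta>0 = (INF b\<in>B. support_function (D_set A K \<mu>) b)"
    and "\<exists>(n::nat) (b :: nat \<Rightarrow> real ^ 'm) (x :: nat \<Rightarrow> 'a).
           (\<forall>i<n. b i \<in> B_hat A K B \<mu> \<eta>0 \<and> x i \<in> K \<and> A (x i) = b i \<and> \<mu> \<bullet> x i = \<eta>0) \<and>
           (\<Sum>i<n. x i) \<in> interior K"
  shows "K_minimal A K B \<mu> \<eta>0"
proof -
  have valid: "valid_inequality A K B \<mu> \<eta>0" and "\<mu> \<noteq> 0"
    using assms(7) by (auto simp: K_sublinear_def valid_inequality_def)
  obtain n :: nat and b x where
    x: "\<And>i. i < n \<Longrightarrow> b i \<in> B_hat A K B \<mu> \<eta>0 \<and> x i \<in> K \<and> A (x i) = b i \<and> \<mu> \<bullet> x i = \<eta>0"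
    and int: "(\<Sum>i<n. x i) \<in> interior K"
    using assms(9) by blast
  have "\<rho>0 < \<eta>0"
    if \<rho>: "valid_inequality A K B \<rho> \<rho>0" "\<rho> \<noteq> \<mu>" "\<mu> - \<rho> \<in> dual_cone K" for \<rho> \<rho>0
  proof (rule ccontr)
    assume "\<not> \<rho>0 < \<eta>0"
    have "(\<mu> - \<rho>) \<bullet> x i \<le> 0" if "i < n" for i
    proof -
      have "x i \<in> solution_set A K B"
        using x[OF that] by (auto simp: solution_set_def B_hat_def)
      then have "\<rho>0 \<le> \<rho> \<bullet> x i"
        using \<rho>(1) by (simp add: valid_inequality_def)
      then show ?thesis
        using x[OF that] \<open>\<not> \<rho>0 < \<eta>0\<close> by (simp add: inner_diff_left)
    qed
    then have "(\<mu> - \<rho>) \<bullet> (\<Sum>i<n. x i) \<le> 0"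
      unfolding inner_sum_right by (intro sum_nonpos) simp
    moreover have "0 < (\<mu> - \<rho>) \<bullet> (\<Sum>i<n. x i)"
      using dual_cone_inner_pos_interior[OF \<rho>(3) _ int] \<rho>(2) by simp
    ultimately show False
      by linarith
  qed
  then show ?thesis
    using valid \<open>\<mu> \<noteq> 0\<close> by (auto simp: K_minimal_def)
qed

end
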